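(* The LDQL operators $\mathsf{AND}$ and $\mathsf{UNION}$ are associative and commutative with respect to semantic equivalence; that is, for all LDQL queries $q_1,q_2,q_3$: $(q_1\,\mathsf{AND}\,q_2)\equiv(q_2\,\mathsf{AND}\,q_1)$, $(q_1\,\mathsf{UNION}\,q_2)\equiv(q_2\,\mathsf{UNION}\,q_1)$, $(q_1\,\mathsf{AND}\,(q_2\,\mathsf{AND}\,q_3))\equiv((q_1\,\mathsf{AND}\,q_2)\,\mathsf{AND}\,q_3)$, and $(q_1\,\mathsf{UNION}\,(q_2\,\mathsf{UNION}\,q_3))\equiv((q_1\,\mathsf{UNION}\,q_2)\,\mathsf{UNION}\,q_3)$.
   Context: **Data model.** $\mathcal U$ (URIs), $\mathcal B$ (blank nodes), $\mathcal L$ (literals), $\mathcal V$ (variables, written $?v,?x,\dots$) and $\mathcal D$ (documents) are pairwise disjoint infinite sets. An RDF triple is an element of $\mathcal T=(\mathcal U\cup\mathcal B)\times\mathcal U\times(\mathcal U\cup\mathcal B\cup\mathcal L)$; $\mathrm{uris}(t)$ is the set of URIs in the triple $t$. Each document $d$ carries a finite set of triples $\mathrm{data}(d)\subseteq\mathcal T$, distinct documents using disjoint sets of blank nodes. A Web of Linked Data is $W=\langle D,adoc\rangle$ with $D\subseteq\mathcal D$ finite and $adoc:\mathcal U\to D$ a partial surjective function with domain $\mathrm{dom}(adoc)$. The link graph $\mathcal G_W$ has node set $D$ and edges $\langle d,(t,u),d'\rangle$ for all $d\in D$, $t\in\mathrm{data}(d)$, $u\in\mathrm{uris}(t)\cap\mathrm{dom}(adoc)$,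 $d'=adoc(u)$. **SPARQL.** A solution mapping $\mu$ is a partial function with finite domain from $\mathcal V$ to $\mathcal U\cup\mathcal B\cup\mathcal L$; $\mu[\alpha]=\mu(\alpha)$ if $\alpha\in\mathrm{dom}(\mu)$, else $\mu[\alpha]=\alpha$ (extended componentwise to triples). $\mu,\mu'$ are compatible if they agree on $\mathrm{dom}(\mu)\cap\mathrm{dom}(\mu')$. $\Omega_1\Join\Omega_2=\{\mu_1\cup\mu_2\mid\mu_i\in\Omega_i\text{ compatible}\}$. An RDF dataset $\mathfrak D$ consists of a default graph and finitely or infinitely many named graphs $\langle u,G_u\rangle$ with pairwise distinct names $u\in\mathcal U$. Graph patterns: finite sets $B$ of triple patterns from $(\mathcal U\cup\mathcal L\cup\mathcal V)\times(\mathcal U\cup\mathcal V)\times(\mathcal U\cup\mathcal L\cup\mathcal V)$ (basic graph patterns, possibly the empty one $\{\,\}$; a triple pattern is identified with a singleton), and $(P_1\,\mathsf{AND}\,P_2)$, $(P_1\,\mathsf{UNION}\,P_2)$, $(P_1\,\mathsf{OPT}\,P_2)$, $(P_1\,\mathsf{FILTER}\,R)$, $(\mathsf{GRAPH}\ c\ P_1)$ with $c\in\mathcal U\cup\mathcal V$, $(P_1\,\mathsf{BIND}(e\,\mathsf{AS}\,?v))$ with $e\in\mathcal U\cup\mathcal L\cup\mathcal V$ and $?v$ not occurring in $P_1$. Filter conditions are Boolean combinations of $\mathrm{bound}(?x)$, $?x=c$, $?x=?y$ (atoms with an unbound variable are false). Evaluation $[\![P]\!]^{\mathfrak D}_G$: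 $[\![B]\!]=\{\mu\mid\mathrm{dom}(\mu)=\mathrm{var}(B),\mu[B]\subseteq G\}$; $\mathsf{AND}$ is $\Join$; $\mathsf{UNION}$ is $\cup$; $\mathsf{OPT}$ gives $(\Omega_1\Join\Omega_2)\cup\{\mu\in\Omega_1\mid\text{no }\mu'\in\Omega_2\text{ compatible with }\mu\}$; $\mathsf{FILTER}$ selects the mappings satisfying $R$; $[\![\mathsf{GRAPH}\ u\ P_1]\!]^{\mathfrak D}_G=[\![P_1]\!]^{\mathfrak D}_{G_u}$ ($G_u=\emptyset$ if $u$ is not a name in $\mathfrak D$); $[\![\mathsf{GRAPH}\ ?x\ P_1]\!]^{\mathfrak D}_G=\bigcup_{u\text{ name in }\mathfrak D}([\![P_1]\!]^{\mathfrak D}_{G_u}\Join\{\{?x\mapsto u\}\})$; $\mathsf{BIND}$ extends each mapping $\mu$ by $?v\mapsto\mu[e]$ (leaving $\mu$ unchanged if $e$ is an unbound variable). **LDQL.** A link pattern is a tuple in $(\mathcal U\cup\{\_,+\})\times(\mathcal U\cup\{\_,+\})\times(\mathcal U\cup\mathcal L\cup\{\_,+\})$. An edge with label $(\langle x_1,x_2,x_3\rangle,u)$ matches $\langle y_1,y_2,y_3\rangle$ in the context of URI $u_c$ if (1) some $i$ has $y_i=\_$ and $x_i=u$, and (2) for each $i$: $y_i=+$ and $x_i=u_c$, or $y_i=x_i$, or $y_i=\_$. LDQL queries $q$ and link path expressions (LPEs) $lpe$ are given by $q:=\langle lpe,P\rangle\mid(\mathsf{SEED}\ U\ q)\mid(\mathsf{SEED}\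 ?v\ q)\mid(q\,\mathsf{AND}\,q)\mid(q\,\mathsf{UNION}\,q)\mid\pi_Vq$, $lpe:=\varepsilon\mid lp\mid lpe/lpe\mid lpe|lpe\mid lpe^*\mid[lpe]\mid\langle ?v,q\rangle$, with $lp$ a link pattern, $P$ a graph pattern, $U$ a finite set of URIs, $V$ a finite set of variables. $\mathrm{dataset}_W(U)$ is the dataset with default graph $\bigcup_{u\in U\cap\mathrm{dom}(adoc)}\mathrm{data}(adoc(u))$ and named graphs $\langle u,\mathrm{data}(adoc(u))\rangle$ for $u\in U\cap\mathrm{dom}(adoc)$. For finite $S\subseteq\mathcal U$: $[\![\langle lpe,P\rangle]\!]^S_W=[\![P]\!]^{\mathfrak D}_G$ with $\mathfrak D=\mathrm{dataset}_W(\bigcup_{u\in S}[\![lpe]\!]^u_W)$ and $G$ its default graph; $[\![(\mathsf{SEED}\ U\ q)]\!]^S_W=[\![q]\!]^U_W$; $[\![(\mathsf{SEED}\ ?v\ q)]\!]^S_W=\bigcup_{u\in\mathcal U}([\![q]\!]^{\{u\}}_W\Join\{\{?v\mapsto u\}\})$; $[\![(q_1\,\mathsf{UNION}\,q_2)]\!]^S_W=[\![q_1]\!]^S_W\cup[\![q_2]\!]^S_W$; $[\![(q_1\,\mathsf{AND}\,q_2)]\!]^S_W=[\![q_1]\!]^S_W\Join[\![q_2]\!]^S_W$; $[\![\pi_Vq]\!]^S_W$ consists of the restrictions of the mappings in $[\![q]\!]^S_W$ to $V$. For $u_c\in\mathrm{dom}(adoc)$: $[\![\varepsilon]\!]^{u_c}_W=\{u_c\}$;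 $[\![lp]\!]^{u_c}_W$ is the set of URIs $u$ such that some edge $\langle adoc(u_c),(t,u),d'\rangle\in\mathcal G_W$ matches $lp$ in the context of $u_c$; $[\![l_1/l_2]\!]^{u_c}_W=\bigcup_{u'\in[\![l_1]\!]^{u_c}_W}[\![l_2]\!]^{u'}_W$; $[\![l_1|l_2]\!]^{u_c}_W$ is the union; $[\![l^*]\!]^{u_c}_W=\{u_c\}\cup[\![l]\!]^{u_c}_W\cup[\![l/l]\!]^{u_c}_W\cup\cdots$; $[\![[l]]\!]^{u_c}_W=\{u_c\}$ if $[\![l]\!]^{u_c}_W\ne\emptyset$, else $\emptyset$; $[\![\langle ?v,q\rangle]\!]^{u_c}_W=\{u\in\mathcal U\mid\mu(?v)=u\text{ for some }\mu\in[\![q]\!]^{\{u_c\}}_W\}$. If $u_c\notin\mathrm{dom}(adoc)$ then $[\![lpe]\!]^{u_c}_W=\emptyset$. **Equivalence.** $q\equiv q'$ means $[\![q]\!]^S_W=[\![q']\!]^S_W$ for every Web of Linked Data $W$ and every finite $S\subseteq\mathcal U$. *)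

theory Defs
  imports Main "HOL-Library.Finite_Map" "HOL-Library.Infinite_Typeclass"
begin

section \<open>Data model\<close>

text \<open>
  The pairwise disjoint infinite sets of URIs, blank nodes, literals, variables and documents
  are the type parameters \<open>'u\<close>, \<open>'b\<close>, \<open>'l\<close>, \<open>'v\<close>, \<open>'d\<close>; the constructors below keep them apart.
\<close>

datatype ('u, 'b, 'l) rdf_term = URI 'u | BNode 'b | Lit 'l

type_synonym ('u, 'b, 'l) triple =
  "('u, 'b, 'l) rdf_term \<times> ('u, 'b, 'l) rdf_term \<times> ('u, 'b, 'l) rdf_term"

definition rdf_triples :: "('u, 'b, 'l) triple set" where
  "rdf_triples = (range URI \<union> range BNode) \<times> range URI \<times> (range URI \<union> range BNode \<union> range Lit)"

fun terms :: "('u, 'b, 'l) triple \<Rightarrow> ('u, 'b, 'l) rdf_term set" where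
  "terms (s, p, ob) = {s, p, ob}"

definition uris :: "('u, 'b, 'l) triple \<Rightarrow> 'u set" where
  "uris t = {u. URI u \<in> terms t}"

definition bnodes :: "('u, 'b, 'l) triple \<Rightarrow> 'b set" where
  "bnodes t = {b. BNode b \<in> terms t}"

text \<open>The conditions on the ambient function \<open>data\<close>, which is shared by all Webs.\<close>

definition document_data :: "('d \<Rightarrow> ('u, 'b, 'l) triple set) \<Rightarrow> bool" where
  "document_data data \<longleftrightarrow>
     (\<forall>d. finite (data d) \<and> data d \<subseteq> rdf_triples) \<and>
     (\<forall>d d'. d \<noteq> d' \<longrightarrow> (\<Union>t\<in>data d. bnodes t) \<inter> (\<Union>t\<in>data d'. bnodes t) = {})"

record ('u, 'd) web =
  docs :: "'d set"
  adoc :: "'u \<rightharpoonup> 'd"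

definition web_of_linked_data :: "('u, 'd) web \<Rightarrow> bool" where
  "web_of_linked_data W \<longleftrightarrow> finite (docs W) \<and> ran (adoc W) = docs W"

definition link_graph ::
  "('d \<Rightarrow> ('u, 'b, 'l) triple set) \<Rightarrow> ('u, 'd) web \<Rightarrow> ('d \<times> (('u, 'b, 'l) triple \<times> 'u) \<times> 'd) set" where
  "link_graph data W =
     {(d, (t, u), d'). d \<in> docs W \<and> t \<in> data d \<and> u \<in> uris t \<inter> dom (adoc W) \<and> d' = the (adoc W u)}"


section \<open>SPARQL\<close>

subsection \<open>Solution mappings\<close>

type_synonym ('u, 'b, 'l, 'v) mapping = "('v, ('u, 'b, 'l) rdf_term) fmap"

definition compatible :: "('u, 'b, 'l, 'v) mapping \<Rightarrow> ('u, 'b, 'l, 'v) mapping \<Rightarrow> bool" where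
  "compatible \<mu> \<mu>' \<longleftrightarrow> (\<forall>x \<in> fmdom' \<mu> \<inter> fmdom' \<mu>'. fmlookup \<mu> x = fmlookup \<mu>' x)"

text \<open>
  \<open>fmadd\<close> lets its second argument override the first; on compatible mappings this is their union.
\<close>

definition join ::
  "('u, 'b, 'l, 'v) mapping set \<Rightarrow> ('u, 'b, 'l, 'v) mapping set \<Rightarrow> ('u, 'b, 'l, 'v) mapping set"
  (infixl "\<Join>" 65) where
  "\<Omega>1 \<Join> \<Omega>2 = {fmadd \<mu>1 \<mu>2 | \<mu>1 \<mu>2. \<mu>1 \<in> \<Omega>1 \<and> \<mu>2 \<in> \<Omega>2 \<and> compatible \<mu>1 \<mu>2}"

definition bind_uri :: "'v \<Rightarrow> 'u \<Rightarrow> ('u, 'b, 'l, 'v) mapping" where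
  "bind_uri v u = fmupd v (URI u) fmempty"

subsection \<open>Graph patterns\<close>

text \<open>
  Patterns contain no blank nodes, so their constants are URIs and literals only.
  \<open>('c, 'v) arg\<close> is the disjoint union of a set of constants with the variables.
\<close>

datatype ('u, 'l) const = CURI 'u | CLit 'l

datatype ('c, 'v) arg = Const 'c | Var 'v

primrec const_term :: "('u, 'l) const \<Rightarrow> ('u, 'b, 'l) rdf_term" where
  "const_term (CURI u) = URI u"
| "const_term (CLit l) = Lit l"

type_synonym ('u, 'l, 'v) triple_pattern =
  "(('u, 'l) const, 'v) arg \<times> ('u, 'v) arg \<times> (('u, 'l) const, 'v) arg"

datatype ('u, 'l, 'v) filter_cond =
    Bound 'v
  | EqConst 'v "('u, 'l) const"
  | EqVar 'v 'v
  | FNot "('u, 'l, 'v) filter_cond"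
  | FAnd "('u, 'l, 'v) filter_cond" "('u, 'l, 'v) filter_cond"
  | FOr "('u, 'l, 'v) filter_cond" "('u, 'l, 'v) filter_cond"

datatype ('u, 'l, 'v) pattern =
    BGP "('u, 'l, 'v) triple_pattern fset"
  | PAnd "('u, 'l, 'v) pattern" "('u, 'l, 'v) pattern"
  | PUnion "('u, 'l, 'v) pattern" "('u, 'l, 'v) pattern"
  | POpt "('u, 'l, 'v) pattern" "('u, 'l, 'v) pattern"
  | PFilter "('u, 'l, 'v) pattern" "('u, 'l, 'v) filter_cond"
  | PGraph "('u, 'v) arg" "('u, 'l, 'v) pattern"
  | PBind "('u, 'l, 'v) pattern" "(('u, 'l) const, 'v) arg" 'v

primrec arg_vars :: "('c, 'v) arg \<Rightarrow> 'v set" where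
  "arg_vars (Const c) = {}"
| "arg_vars (Var v) = {v}"

fun tp_vars :: "('u, 'l, 'v) triple_pattern \<Rightarrow> 'v set" where
  "tp_vars (s, p, ob) = arg_vars s \<union> arg_vars p \<union> arg_vars ob"

primrec filter_vars :: "('u, 'l, 'v) filter_cond \<Rightarrow> 'v set" where
  "filter_vars (Bound x) = {x}"
| "filter_vars (EqConst x c) = {x}"
| "filter_vars (EqVar x y) = {x, y}"
| "filter_vars (FNot R) = filter_vars R"
| "filter_vars (FAnd R1 R2) = filter_vars R1 \<union> filter_vars R2"
| "filter_vars (FOr R1 R2) = filter_vars R1 \<union> filter_vars R2"

primrec pattern_vars :: "('u, 'l, 'v) pattern \<Rightarrow> 'v set" where
  "pattern_vars (BGP B) = (\<Union>tp\<in>fset B. tp_vars tp)"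
| "pattern_vars (PAnd P1 P2) = pattern_vars P1 \<union> pattern_vars P2"
| "pattern_vars (PUnion P1 P2) = pattern_vars P1 \<union> pattern_vars P2"
| "pattern_vars (POpt P1 P2) = pattern_vars P1 \<union> pattern_vars P2"
| "pattern_vars (PFilter P R) = pattern_vars P \<union> filter_vars R"
| "pattern_vars (PGraph c P) = arg_vars c \<union> pattern_vars P"
| "pattern_vars (PBind P e v) = pattern_vars P \<union> arg_vars e \<union> {v}"

text \<open>The only syntactic restriction not enforced by the types is that of \<open>BIND\<close>.\<close>

primrec wf_pattern :: "('u, 'l, 'v) pattern \<Rightarrow> bool" where
  "wf_pattern (BGP B) = True"
| "wf_pattern (PAnd P1 P2) = (wf_pattern P1 \<and> wf_pattern P2)"
| "wf_pattern (PUnion P1 P2) = (wf_pattern P1 \<and> wf_pattern P2)"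
| "wf_pattern (POpt P1 P2) = (wf_pattern P1 \<and> wf_pattern P2)"
| "wf_pattern (PFilter P R) = wf_pattern P"
| "wf_pattern (PGraph c P) = wf_pattern P"
| "wf_pattern (PBind P e v) = (wf_pattern P \<and> v \<notin> pattern_vars P)"

subsection \<open>Evaluation\<close>

type_synonym ('u, 'b, 'l) graph = "('u, 'b, 'l) triple set"

record ('u, 'b, 'l) dataset =
  default_graph :: "('u, 'b, 'l) graph"
  named_graphs :: "'u \<rightharpoonup> ('u, 'b, 'l) graph"

text \<open>
  \<open>subst \<mu> \<alpha>\<close> is $\mu[\alpha]$. Pattern positions are first embedded into \<open>(rdf_term, 'v) arg\<close>, where
  unbound variables can remain.
\<close>

primrec subst ::
  "('u, 'b, 'l, 'v) mapping \<Rightarrow> (('u, 'b, 'l) rdf_term, 'v) arg \<Rightarrow> (('u, 'b, 'l) rdf_term, 'v) arg" where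
  "subst \<mu> (Const c) = Const c"
| "subst \<mu> (Var x) = (case fmlookup \<mu> x of Some c \<Rightarrow> Const c | None \<Rightarrow> Var x)"

fun subst_tp ::
  "('u, 'b, 'l, 'v) mapping \<Rightarrow> ('u, 'l, 'v) triple_pattern \<Rightarrow>
   (('u, 'b, 'l) rdf_term, 'v) arg \<times> (('u, 'b, 'l) rdf_term, 'v) arg \<times> (('u, 'b, 'l) rdf_term, 'v) arg" where
  "subst_tp \<mu> (s, p, ob) =
     (subst \<mu> (map_arg const_term id s), subst \<mu> (map_arg URI id p), subst \<mu> (map_arg const_term id ob))"

fun ground_triple ::
  "('u, 'b, 'l) triple \<Rightarrow>
   (('u, 'b, 'l) rdf_term, 'v) arg \<times> (('u, 'b, 'l) rdf_term, 'v) arg \<times> (('u, 'b, 'l) rdf_term, 'v) arg" where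
  "ground_triple (s, p, ob) = (Const s, Const p, Const ob)"

primrec sat :: "('u, 'b, 'l, 'v) mapping \<Rightarrow> ('u, 'l, 'v) filter_cond \<Rightarrow> bool" where
  "sat \<mu> (Bound x) = (x \<in> fmdom' \<mu>)"
| "sat \<mu> (EqConst x c) = (fmlookup \<mu> x = Some (const_term c))"
| "sat \<mu> (EqVar x y) = (x \<in> fmdom' \<mu> \<and> y \<in> fmdom' \<mu> \<and> fmlookup \<mu> x = fmlookup \<mu> y)"
| "sat \<mu> (FNot R) = (\<not> sat \<mu> R)"
| "sat \<mu> (FAnd R1 R2) = (sat \<mu> R1 \<and> sat \<mu> R2)"
| "sat \<mu> (FOr R1 R2) = (sat \<mu> R1 \<or> sat \<mu> R2)"

primrec eval_pattern ::
  "('u, 'b, 'l) dataset \<Rightarrow> ('u, 'l, 'v) pattern \<Rightarrow> ('u, 'b, 'l) graph \<Rightarrow> ('u, 'b, 'l, 'v) mapping set" where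
  "eval_pattern \<DD> (BGP B) G =
     {\<mu>. fmdom' \<mu> = pattern_vars (BGP B) \<and> subst_tp \<mu> ` fset B \<subseteq> ground_triple ` G}"
| "eval_pattern \<DD> (PAnd P1 P2) G = eval_pattern \<DD> P1 G \<Join> eval_pattern \<DD> P2 G"
| "eval_pattern \<DD> (PUnion P1 P2) G = eval_pattern \<DD> P1 G \<union> eval_pattern \<DD> P2 G"
| "eval_pattern \<DD> (POpt P1 P2) G =
     (eval_pattern \<DD> P1 G \<Join> eval_pattern \<DD> P2 G) \<union>
     {\<mu> \<in> eval_pattern \<DD> P1 G. \<not> (\<exists>\<mu>' \<in> eval_pattern \<DD> P2 G. compatible \<mu> \<mu>')}"
| "eval_pattern \<DD> (PFilter P R) G = {\<mu> \<in> eval_pattern \<DD> P G. sat \<mu> R}"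
| "eval_pattern \<DD> (PGraph c P) G =
     (case c of
        Const u \<Rightarrow> eval_pattern \<DD> P (case named_graphs \<DD> u of Some G' \<Rightarrow> G' | None \<Rightarrow> {})
      | Var x \<Rightarrow> (\<Union>u \<in> dom (named_graphs \<DD>).
                   eval_pattern \<DD> P (the (named_graphs \<DD> u)) \<Join> {bind_uri x u}))"
| "eval_pattern \<DD> (PBind P e v) G =
     (\<lambda>\<mu>. case subst \<mu> (map_arg const_term id e) of Const c \<Rightarrow> fmupd v c \<mu> | Var _ \<Rightarrow> \<mu>)
       ` eval_pattern \<DD> P G"


section \<open>LDQL\<close>

subsection \<open>Syntax\<close>

text \<open>\<open>Wild\<close> is the symbol $\_$ and \<open>Ctx\<close> is the symbol $+$ of link patterns.\<close>

datatype 'c slot = Is 'c | Wild | Ctx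

type_synonym ('u, 'l) link_pattern = "'u slot \<times> 'u slot \<times> ('u, 'l) const slot"

datatype ('u, 'l, 'v) ldql =
    Basic "('u, 'l, 'v) lpe" "('u, 'l, 'v) pattern"
  | SeedURIs "'u fset" "('u, 'l, 'v) ldql"
  | SeedVar 'v "('u, 'l, 'v) ldql"
  | QAnd "('u, 'l, 'v) ldql" "('u, 'l, 'v) ldql"
  | QUnion "('u, 'l, 'v) ldql" "('u, 'l, 'v) ldql"
  | Project "'v fset" "('u, 'l, 'v) ldql"
and ('u, 'l, 'v) lpe =
    Eps
  | Link "('u, 'l) link_pattern"
  | Seq "('u, 'l, 'v) lpe" "('u, 'l, 'v) lpe"
  | Alt "('u, 'l, 'v) lpe" "('u, 'l, 'v) lpe"
  | Star "('u, 'l, 'v) lpe"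
  | Test "('u, 'l, 'v) lpe"
  | Sub 'v "('u, 'l, 'v) ldql"

primrec wf_ldql :: "('u, 'l, 'v) ldql \<Rightarrow> bool"
  and wf_lpe :: "('u, 'l, 'v) lpe \<Rightarrow> bool" where
  "wf_ldql (Basic l P) = (wf_lpe l \<and> wf_pattern P)"
| "wf_ldql (SeedURIs U q) = wf_ldql q"
| "wf_ldql (SeedVar v q) = wf_ldql q"
| "wf_ldql (QAnd q1 q2) = (wf_ldql q1 \<and> wf_ldql q2)"
| "wf_ldql (QUnion q1 q2) = (wf_ldql q1 \<and> wf_ldql q2)"
| "wf_ldql (Project V q) = wf_ldql q"
| "wf_lpe Eps = True"
| "wf_lpe (Link lp) = True"
| "wf_lpe (Seq l1 l2) = (wf_lpe l1 \<and> wf_lpe l2)"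
| "wf_lpe (Alt l1 l2) = (wf_lpe l1 \<and> wf_lpe l2)"
| "wf_lpe (Star l) = wf_lpe l"
| "wf_lpe (Test l) = wf_lpe l"
| "wf_lpe (Sub v q) = wf_ldql q"

subsection \<open>Semantics\<close>

fun slot_matches :: "'u \<Rightarrow> ('u, 'b, 'l) rdf_term \<Rightarrow> ('u, 'b, 'l) rdf_term slot \<Rightarrow> bool" where
  "slot_matches uc x Ctx = (x = URI uc)"
| "slot_matches uc x (Is y) = (y = x)"
| "slot_matches uc x Wild = True"

fun link_matches :: "'u \<Rightarrow> ('u, 'b, 'l) triple \<times> 'u \<Rightarrow> ('u, 'l) link_pattern \<Rightarrow> bool" where
  "link_matches uc ((x1, x2, x3), u) (y1, y2, y3) \<longleftrightarrow>
     (y1 = Wild \<and> x1 = URI u \<or> y2 = Wild \<and> x2 = URI u \<or> y3 = Wild \<and> x3 = URI u) \<and>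
     slot_matches uc x1 (map_slot URI y1) \<and>
     slot_matches uc x2 (map_slot URI y2) \<and>
     slot_matches uc x3 (map_slot const_term y3)"

definition dataset_of ::
  "('d \<Rightarrow> ('u, 'b, 'l) triple set) \<Rightarrow> ('u, 'd) web \<Rightarrow> 'u set \<Rightarrow> ('u, 'b, 'l) dataset" where
  "dataset_of data W U =
     \<lparr>default_graph = (\<Union>u \<in> U \<inter> dom (adoc W). data (the (adoc W u))),
      named_graphs = (\<lambda>u. map_option data (adoc W u)) |` U\<rparr>"

text \<open>
  In the clause for \<open>Star\<close>, the \<open>n\<close>-th power of the relation defined by \<open>l\<close> is the one defined by
  \<open>l / \<dots> / l\<close> with \<open>n\<close> factors, the power \<open>0\<close> giving the context URI itself.
\<close>

primrec eval_ldql ::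
    "('d \<Rightarrow> ('u, 'b, 'l) triple set) \<Rightarrow> ('u, 'd) web \<Rightarrow> ('u, 'l, 'v) ldql \<Rightarrow> 'u set \<Rightarrow>
     ('u, 'b, 'l, 'v) mapping set"
  and eval_lpe ::
    "('d \<Rightarrow> ('u, 'b, 'l) triple set) \<Rightarrow> ('u, 'd) web \<Rightarrow> ('u, 'l, 'v) lpe \<Rightarrow> 'u \<Rightarrow> 'u set" where
  "eval_ldql data W (Basic l P) S =
     (let \<DD> = dataset_of data W (\<Union>u\<in>S. eval_lpe data W l u)
      in eval_pattern \<DD> P (default_graph \<DD>))"
| "eval_ldql data W (SeedURIs U q) S = eval_ldql data W q (fset U)"
| "eval_ldql data W (SeedVar v q) S = (\<Union>u. eval_ldql data W q {u} \<Join> {bind_uri v u})"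
| "eval_ldql data W (QAnd q1 q2) S = eval_ldql data W q1 S \<Join> eval_ldql data W q2 S"
| "eval_ldql data W (QUnion q1 q2) S = eval_ldql data W q1 S \<union> eval_ldql data W q2 S"
| "eval_ldql data W (Project V q) S = fmrestrict_fset V ` eval_ldql data W q S"
| "eval_lpe data W Eps uc = (if uc \<in> dom (adoc W) then {uc} else {})"
| "eval_lpe data W (Link lp) uc =
     (if uc \<in> dom (adoc W)
      then {u. \<exists>t d'. (the (adoc W uc), (t, u), d') \<in> link_graph data W \<and> link_matches uc (t, u) lp}
      else {})"
| "eval_lpe data W (Seq l1 l2) uc =
     (if uc \<in> dom (adoc W) then (\<Union>u' \<in> eval_lpe data W l1 uc. eval_lpe data W l2 u') else {})"
| "eval_lpe data W (Alt l1 l2) uc =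
     (if uc \<in> dom (adoc W) then eval_lpe data W l1 uc \<union> eval_lpe data W l2 uc else {})"
| "eval_lpe data W (Star l) uc =
     (if uc \<in> dom (adoc W) then (\<Union>n::nat. ({(x, y). y \<in> eval_lpe data W l x} ^^ n) `` {uc}) else {})"
| "eval_lpe data W (Test l) uc =
     (if uc \<in> dom (adoc W) \<and> eval_lpe data W l uc \<noteq> {} then {uc} else {})"
| "eval_lpe data W (Sub v q) uc =
     (if uc \<in> dom (adoc W) then {u. \<exists>\<mu> \<in> eval_ldql data W q {uc}. fmlookup \<mu> v = Some (URI u)} else {})"

definition ldql_equiv ::
  "('d \<Rightarrow> ('u, 'b, 'l) triple set) \<Rightarrow> ('u, 'l, 'v) ldql \<Rightarrow> ('u, 'l, 'v) ldql \<Rightarrow> bool" where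
  "ldql_equiv data q q' \<longleftrightarrow>
     (\<forall>W S. web_of_linked_data W \<longrightarrow> finite S \<longrightarrow> eval_ldql data W q S = eval_ldql data W q' S)"

end

theory Submission
  imports Defs
begin

text \<open>For a fixed Web and seed set, \<open>QAnd\<close> and \<open>QUnion\<close> evaluate to
  the join and the union of the operands' solution sets, so all four laws are identities of sets of
  mappings; those for union are elementary. For the join, view a mapping as its graph: compatible
  mappings are those whose graphs have a single-valued union, and \<open>fmadd\<close> then is this
  union. Hence \<open>join_commute\<close>; and by \<open>compatible_fmadd_left\<close>, both
  bracketings in \<open>join_assoc\<close> collect the unions of pairwise compatible
  triples.\<close>

lemma compatible_iff:
  "compatible \<mu> \<mu>' \<longleftrightarrow>
     (\<forall>x a b. fmlookup \<mu> x = Some a \<longrightarrow> fmlookup \<mu>' x = Some b \<longrightarrow> a = b)"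
  unfolding compatible_def Ball_def Int_iff fmlookup_dom'_iff by (metis option.inject)

lemma compatible_commute: "compatible \<mu> \<mu>' \<longleftrightarrow> compatible \<mu>' \<mu>"
  unfolding compatible_iff by metis

text \<open>Overriding is asymmetric only where the two mappings disagree, which compatibility
  excludes.\<close>

lemma fmadd_commute:
  assumes "compatible \<mu> \<mu>'"
  shows "fmadd \<mu> \<mu>' = fmadd \<mu>' \<mu>"
proof (rule fmap_ext)
  fix x
  show "fmlookup (fmadd \<mu> \<mu>') x = fmlookup (fmadd \<mu>' \<mu>) x"
    using assms unfolding compatible_iff
    by (cases "fmlookup \<mu> x"; cases "fmlookup \<mu>' x") (auto simp: fmlookup_dom_iff)
qed

text \<open>Since \<open>\<mu>1\<close> and \<open>\<mu>2\<close> agree where both are defined, no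
  binding of \<open>\<mu>1\<close> is lost to the override, so a clash with \<open>\<mu>3\<close> is
  a clash of \<open>\<mu>1\<close> or of \<open>\<mu>2\<close> with it.\<close>

lemma compatible_fmadd_left:
  assumes "compatible \<mu>1 \<mu>2"
  shows "compatible (fmadd \<mu>1 \<mu>2) \<mu>3 \<longleftrightarrow> compatible \<mu>1 \<mu>3 \<and> compatible \<mu>2 \<mu>3"
proof -
  have "fmlookup (fmadd \<mu>1 \<mu>2) x = Some a \<longleftrightarrow> fmlookup \<mu>1 x = Some a \<or> fmlookup \<mu>2 x = Some a" for x a
    using assms unfolding compatible_iff
    by (cases "fmlookup \<mu>1 x"; cases "fmlookup \<mu>2 x") (auto simp: map_add_def)
  then show ?thesis
    unfolding compatible_iff by blast
qed

lemma compatible_fmadd_right: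
  assumes "compatible \<mu>2 \<mu>3"
  shows "compatible \<mu>1 (fmadd \<mu>2 \<mu>3) \<longleftrightarrow> compatible \<mu>1 \<mu>2 \<and> compatible \<mu>1 \<mu>3"
  using compatible_fmadd_left[OF assms] by (simp add: compatible_commute[of \<mu>1])

lemma join_commute:
  fixes \<Omega>1 \<Omega>2 :: "('u, 'b, 'l, 'v) mapping set"
  shows "\<Omega>1 \<Join> \<Omega>2 = \<Omega>2 \<Join> \<Omega>1"
proof -
  \<comment> \<open>Generalised over both sets, so that the swapped instance is the converse
    inclusion.\<close>
  have "\<Omega>1 \<Join> \<Omega>2 \<subseteq> \<Omega>2 \<Join> \<Omega>1" for \<Omega>1 \<Omega>2 :: "('u, 'b, 'l, 'v) mapping set"
    unfolding join_def using compatible_commute fmadd_commute by blast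
  then show ?thesis by blast
qed

lemma join_assoc: "\<Omega>1 \<Join> (\<Omega>2 \<Join> \<Omega>3) = (\<Omega>1 \<Join> \<Omega>2) \<Join> \<Omega>3"
proof (intro set_eqI iffI)
  fix \<mu> assume "\<mu> \<in> \<Omega>1 \<Join> (\<Omega>2 \<Join> \<Omega>3)"
  \<comment> \<open>The result can be rebracketed at once, as \<open>fmadd\<close> is associative
    even without compatibility; only the side conditions need regrouping.\<close>
  then obtain \<mu>1 \<mu>2 \<mu>3 where \<mu>: "\<mu> = fmadd (fmadd \<mu>1 \<mu>2) \<mu>3" "\<mu>1 \<in> \<Omega>1" "\<mu>2 \<in> \<Omega>2" "\<mu>3 \<in> \<Omega>3"
    and "compatible \<mu>2 \<mu>3" "compatible \<mu>1 (fmadd \<mu>2 \<mu>3)"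
    unfolding join_def by auto
  then have "compatible \<mu>1 \<mu>2" "compatible (fmadd \<mu>1 \<mu>2) \<mu>3"
    by (simp_all add: compatible_fmadd_left compatible_fmadd_right)
  with \<mu> show "\<mu> \<in> (\<Omega>1 \<Join> \<Omega>2) \<Join> \<Omega>3"
    unfolding join_def by blast
next
  fix \<mu> assume "\<mu> \<in> (\<Omega>1 \<Join> \<Omega>2) \<Join> \<Omega>3"
  then obtain \<mu>1 \<mu>2 \<mu>3 where \<mu>: "\<mu> = fmadd \<mu>1 (fmadd \<mu>2 \<mu>3)" "\<mu>1 \<in> \<Omega>1" "\<mu>2 \<in> \<Omega>2" "\<mu>3 \<in> \<Omega>3"
    and "compatible \<mu>1 \<mu>2" "compatible (fmadd \<mu>1 \<mu>2) \<mu>3"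
    unfolding join_def by auto
  then have "compatible \<mu>2 \<mu>3" "compatible \<mu>1 (fmadd \<mu>2 \<mu>3)"
    by (simp_all add: compatible_fmadd_left compatible_fmadd_right)
  with \<mu> show "\<mu> \<in> \<Omega>1 \<Join> (\<Omega>2 \<Join> \<Omega>3)"
    unfolding join_def by blast
qed

theorem lemma1:
  fixes data :: "'d::infinite \<Rightarrow> ('u::infinite, 'b::infinite, 'l::infinite) triple set"
    and q1 q2 q3 :: "('u, 'l, 'v::infinite) ldql"
  assumes "document_data data"
    and "wf_ldql q1" and "wf_ldql q2" and "wf_ldql q3"
  shows "ldql_equiv data (QAnd q1 q2) (QAnd q2 q1) \<and>
         ldql_equiv data (QUnion q1 q2) (QUnion q2 q1) \<and>
         ldql_equiv data (QAnd q1 (QAnd q2 q3)) (QAnd (QAnd q1 q2) q3) \<and>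
         ldql_equiv data (QUnion q1 (QUnion q2 q3)) (QUnion (QUnion q1 q2) q3)"
  unfolding ldql_equiv_def eval_ldql.simps
  by (intro conjI allI impI join_commute join_assoc Un_commute Un_assoc[symmetric])

end
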